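(* Let $p_1=1$ and $\rho>0$, and consider the system $$\mathcal{D}'=2p_1\mathcal{I}\mathcal{D},\qquad \mathcal{R}'=2p_1\mathcal{I}\mathcal{R},\qquad \mathcal{I}'=-2p_1(\mathcal{D}^2+\mathcal{R}^2)$$ on $S^2_\rho$. The two points $(\mathcal{D},\mathcal{R},\mathcal{I})=\pm(0,0,\rho)$ are fixed points. If $(\mathcal{D}(0),\mathcal{R}(0),\mathcal{I}(0))\in S^2_\rho$ and $(\mathcal{D}(0),\mathcal{R}(0),\mathcal{I}(0))\ne\pm(0,0,\rho)$, then the solution is given by $$\mathcal{D}(\tau)=\tfrac{\rho\,\mathcal{D}(0)}{\sqrt{\mathcal{D}(0)^2+\mathcal{R}(0)^2}}\Big(\cosh\big(2p_1\rho\tau-\tanh^{-1}\tfrac{\mathcal{I}(0)}{\rho}\big)\Big)^{-1},$$ $$\mathcal{R}(\tau)=\tfrac{\rho\,\mathcal{R}(0)}{\sqrt{\mathcal{D}(0)^2+\mathcal{R}(0)^2}}\Big(\cosh\big(2p_1\rho\tau-\tanh^{-1}\tfrac{\mathcal{I}(0)}{\rho}\big)\Big)^{-1},$$ $$\mathcal{I}(\tau)=-\rho\tanh\big(2p_1\rho\tau-\tanh^{-1}\tfrac{\mathcal{I}(0)}{\rho}\big).$$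
   Context: $S^2_\rho=\{(x,y,z)\in\mathbb{R}^3: x^2+y^2+z^2=\rho^2\}$; the unknown $(\mathcal{D},\mathcal{R},\mathcal{I})$ is real valued, $\tau\in\mathbb{R}$, and the system preserves $S^2_\rho$. *)

theory Defs
  imports "HOL-Analysis.Analysis"
begin

definition S2 :: "real \<Rightarrow> (real \<times> real \<times> real) set" where
  "S2 \<rho> = {(x, y, z). x\<^sup>2 + y\<^sup>2 + z\<^sup>2 = \<rho>\<^sup>2}"

definition DRI_field :: "real \<Rightarrow> real \<times> real \<times> real \<Rightarrow> real \<times> real \<times> real" where
  "DRI_field p\<^sub>1 = (\<lambda>(D, R, I). (2 * p\<^sub>1 * I * D, 2 * p\<^sub>1 * I * R, - 2 * p\<^sub>1 * (D\<^sup>2 + R\<^sup>2)))"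

text \<open>Derivatives are taken within the time domain \<open>T\<close>, hence are one-sided at endpoints
  belonging to \<open>T\<close>. Solutions are not required to lie on the sphere.\<close>

definition solves_on ::
    "('a::real_normed_vector \<Rightarrow> 'a) \<Rightarrow> (real \<Rightarrow> 'a) \<Rightarrow> real set \<Rightarrow> bool" where
  "solves_on f X T \<longleftrightarrow> (\<forall>\<tau>\<in>T. (X has_vector_derivative f (X \<tau>)) (at \<tau> within T))"

definition fixed_point :: "('a::real_normed_vector \<Rightarrow> 'a) \<Rightarrow> 'a \<Rightarrow> bool" where
  "fixed_point f x \<longleftrightarrow> f x = 0"

end

(* Along a solution Y = (D, R, I) on the sphere, put s = 2 \<rho> \<tau> - artanh (I0 / \<rho>).  The quantity
   W = I cosh s + \<rho> sinh s satisfies the linear equation W' = 2 I W with W(0) = 0 and bounded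
   coefficient, so W vanishes: this is the formula for I.  Since (D cosh s)' = 2 D W and
   (R cosh s)' = 2 R W, the functions D cosh s and R cosh s are constant. *)
theory Submission
  imports Defs
begin

text \<open>A Gronwall argument for u' = g u with |g| \<le> K: weighting \<open>u\<^sup>2\<close> by
  a suitable exponential makes it monotone, so a zero at \<open>t0\<close> propagates along
  \<open>T\<close> in both time directions.\<close>

lemma linear_ode_zero:
  fixes u g :: "real \<Rightarrow> real"
  assumes T: "is_interval T" "t0 \<in> T" "t \<in> T"
    and u: "\<And>s. s \<in> T \<Longrightarrow> (u has_real_derivative g s * u s) (at s within T)"
    and g: "\<And>s. s \<in> T \<Longrightarrow> \<bar>g s\<bar> \<le> K"
    and "u t0 = 0"
  shows "u t = 0"
proof -
  define v where "v c s = (u s)\<^sup>2 * exp (c * s)" for c s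
  have v: "(v c has_real_derivative (2 * g s + c) * v c s) (at s within T)" if "s \<in> T" for c s
    unfolding v_def using u[OF that]
    by (auto intro!: derivative_eq_intros simp: algebra_simps power2_eq_square)
  have v_pos: "v c s \<ge> 0" for c s by (simp add: v_def)
  \<comment> \<open>Derivatives are known only within \<open>T\<close>; since \<open>T\<close> is an
    interval they restrict to {a..b}, where the mean value theorem turns the sign of 2 g + c into
    monotonicity of \<open>v c\<close>.\<close>
  have mvt: "\<exists>z\<in>{a..b}. v c b - v c a = (2 * g z + c) * v c z * (b - a)"
    if "a \<in> T" "b \<in> T" "a \<le> b" for a b c
  proof (rule bexE[OF mvt_very_simple[OF \<open>a \<le> b\<close>]])
    have sub: "{a..b} \<subseteq> T"
      using T(1) that by (meson atLeastAtMost_iff mem_is_interval_1_I subsetI)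
    show "(v c has_derivative (\<lambda>h. (2 * g x + c) * v c x * h)) (at x within {a..b})"
      if "a \<le> x" "x \<le> b" for x
      using DERIV_subset[OF v sub, of x c] sub that by (auto simp: has_field_derivative_def)
  qed auto
  \<comment> \<open>As |2 g| \<le> 2 K, the choice c = -2 K makes \<open>v c\<close> nonincreasing,
    which serves times after \<open>t0\<close>; c = 2 K makes it nondecreasing, which serves times
    before \<open>t0\<close>.\<close>
  have "v c t \<le> v c t0" if c: "t0 \<le> t \<and> c = - 2 * K \<or> t \<le> t0 \<and> c = 2 * K" for c
    using c
  proof
    assume h: "t0 \<le> t \<and> c = - 2 * K"
    then obtain z where z: "z \<in> {t0..t}" "v c t - v c t0 = (2 * g z + c) * v c z * (t - t0)"
      using mvt T by blast
    have "2 * g z + c \<le> 0"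
      using g[of z] z T h by (smt (verit) atLeastAtMost_iff mem_is_interval_1_I)
    then have "(2 * g z + c) * v c z * (t - t0) \<le> 0"
      using v_pos[of c z] h by (intro mult_nonpos_nonneg) auto
    then show ?thesis using z by simp
  next
    assume h: "t \<le> t0 \<and> c = 2 * K"
    then obtain z where z: "z \<in> {t..t0}" "v c t0 - v c t = (2 * g z + c) * v c z * (t0 - t)"
      using mvt T by blast
    have "2 * g z + c \<ge> 0"
      using g[of z] z T h by (smt (verit) atLeastAtMost_iff mem_is_interval_1_I)
    then have "(2 * g z + c) * v c z * (t0 - t) \<ge> 0"
      using v_pos[of c z] h by (intro mult_nonneg_nonneg) auto
    then show ?thesis using z by simp
  qed
  then have "v (if t0 \<le> t then - 2 * K else 2 * K) t \<le> v (if t0 \<le> t then - 2 * K else 2 * K) t0"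
    by auto
  then obtain c where "v c t \<le> v c t0" by blast
  then show ?thesis
    using \<open>u t0 = 0\<close> by (simp add: v_def mult_le_0_iff)
qed

lemma zero_derivative_constant:
  fixes f :: "real \<Rightarrow> real"
  assumes "is_interval T" "s \<in> T" "t \<in> T"
    and "\<And>t. t \<in> T \<Longrightarrow> (f has_real_derivative 0) (at t within T)"
  shows "f t = f s"
  using has_field_derivative_zero_constant[OF is_interval_convex[OF assms(1)] assms(4)] assms(2,3)
  by metis

lemma inverse_cosh_square_real: "(inverse (cosh x))\<^sup>2 = 1 - (tanh x)\<^sup>2" for x :: real
proof -
  have "cosh x \<noteq> 0" using cosh_real_pos[of x] by linarith
  moreover have "(cosh x)\<^sup>2 - (sinh x)\<^sup>2 = 1" by (simp add: cosh_square_eq)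
  ultimately show ?thesis
    by (simp add: tanh_def power_divide divide_simps)
qed

lemma tanh_artanh_real:
  fixes x :: real
  assumes "\<bar>x\<bar> < 1"
  shows "tanh (artanh x) = x"
proof -
  define y where "y = (1 + x) / (1 - x)"
  have x: "1 + x > 0" "1 - x > 0" using assms by auto
  then have "y > 0" by (simp add: y_def)
  \<comment> \<open>Moving the factor 1/2 of \<open>artanh\<close> into the logarithm gives access
    to tanh (ln z) = (z^2 - 1) / (z^2 + 1) with z = \<open>sqrt y\<close>.\<close>
  then have "artanh x = ln (sqrt y)" by (simp add: artanh_def ln_sqrt y_def)
  then have "tanh (artanh x) = (y - 1) / (y + 1)"
    using \<open>y > 0\<close> by (simp add: tanh_ln_real)
  also have "\<dots> = x" using x by (simp add: y_def field_simps)
  finally show ?thesis .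
qed

lemma cosh_artanh_real:
  fixes x :: real
  assumes "\<bar>x\<bar> < 1"
  shows "cosh (artanh x) = inverse (sqrt (1 - x\<^sup>2))"
proof -
  have "inverse (cosh (artanh x)) = sqrt (1 - x\<^sup>2)"
    using inverse_cosh_square_real[of "artanh x"] cosh_real_pos[of "artanh x"]
    by (intro real_sqrt_unique[symmetric]) (simp_all add: tanh_artanh_real[OF assms])
  then show ?thesis by (metis inverse_inverse_eq)
qed

lemma solves_on_DRI_iff:
  "solves_on (DRI_field 1) (\<lambda>t. (D t, R t, I t)) T \<longleftrightarrow>
    (\<forall>t\<in>T. (D has_real_derivative 2 * I t * D t) (at t within T)
         \<and> (R has_real_derivative 2 * I t * R t) (at t within T)
         \<and> (I has_real_derivative - 2 * ((D t)\<^sup>2 + (R t)\<^sup>2)) (at t within T))"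
proof -
  have *: "((\<lambda>t. (D t, R t, I t)) has_vector_derivative (d, r, i)) (at x within T) \<longleftrightarrow>
      (D has_real_derivative d) (at x within T) \<and> (R has_real_derivative r) (at x within T)
      \<and> (I has_real_derivative i) (at x within T)"
    for d r i x
    \<comment> \<open>The three bounded linear maps are the coordinate projections and give the
      forward direction; pairing the derivatives gives the converse.\<close>
    using bounded_linear.has_vector_derivative[OF bounded_linear_fst,
        of "\<lambda>t. (D t, R t, I t)" "(d, r, i)" "at x within T"]
      bounded_linear.has_vector_derivative[OF
        bounded_linear_compose[OF bounded_linear_fst bounded_linear_snd],
        of "\<lambda>t. (D t, R t, I t)" "(d, r, i)" "at x within T"]
      bounded_linear.has_vector_derivative[OF
        bounded_linear_compose[OF bounded_linear_snd bounded_linear_snd],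
        of "\<lambda>t. (D t, R t, I t)" "(d, r, i)" "at x within T"]
    by (auto simp: has_real_derivative_iff_has_vector_derivative
        intro!: has_vector_derivative_Pair)
  show ?thesis by (simp add: solves_on_def DRI_field_def *)
qed

text \<open>With I = -\<rho> tanh s and s' = 2 \<rho>, the function 1 / cosh s solves u' = 2 I u,
  and I' = -2 \<rho>^2 / cosh^2 s. The condition on \<open>k\<close> and \<open>l\<close> matches
  this with -2 (D^2 + R^2); the phase \<open>a\<close> is free.\<close>

lemma DRI_explicit_solution:
  fixes k l \<rho> a :: real
  assumes "k\<^sup>2 + l\<^sup>2 = \<rho>\<^sup>2"
  defines "s \<equiv> \<lambda>t. 2 * \<rho> * t - a"
  shows "solves_on (DRI_field 1)
    (\<lambda>t. (k * inverse (cosh (s t)), l * inverse (cosh (s t)), - \<rho> * tanh (s t))) T"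
proof -
  have nz: "cosh (s t) \<noteq> 0" for t using cosh_real_pos[of "s t"] by linarith
  have s: "(s has_real_derivative 2 * \<rho>) (at t within T)" for t
    unfolding s_def by (auto intro!: derivative_eq_intros)
  have sech: "((\<lambda>t. m * inverse (cosh (s t))) has_real_derivative
      2 * (- \<rho> * tanh (s t)) * (m * inverse (cosh (s t)))) (at t within T)" for m t
    using nz by (auto intro!: derivative_eq_intros s simp: tanh_def field_simps power2_eq_square)
  have eq: "(k * inverse (cosh (s t)))\<^sup>2 + (l * inverse (cosh (s t)))\<^sup>2 = \<rho>\<^sup>2 * (1 - (tanh (s t))\<^sup>2)" for t
    unfolding power_mult_distrib inverse_cosh_square_real assms(1)[symmetric]
    by (simp add: algebra_simps)
  have "((\<lambda>t. - \<rho> * tanh (s t)) has_real_derivative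
      - 2 * ((k * inverse (cosh (s t)))\<^sup>2 + (l * inverse (cosh (s t)))\<^sup>2)) (at t within T)" for t
    unfolding eq using nz
    by (auto intro!: derivative_eq_intros s simp: algebra_simps power2_eq_square)
  with sech show ?thesis by (simp add: solves_on_DRI_iff)
qed

text \<open>Hypothesis \<open>a\<close> encodes W(0) = 0, because \<open>s 0 = - a\<close>. The
  conclusions are kept free of quotients; dividing by the positive \<open>cosh (s t)\<close>
  determines the solution.\<close>

lemma DRI_first_integrals:
  fixes D R I :: "real \<Rightarrow> real"
  assumes T: "is_interval T" "0 \<in> T" "t \<in> T"
    and sol: "solves_on (DRI_field 1) (\<lambda>t. (D t, R t, I t)) T"
    and sphere: "(D 0)\<^sup>2 + (R 0)\<^sup>2 + (I 0)\<^sup>2 = \<rho>\<^sup>2"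
    and a: "I 0 * cosh a = \<rho> * sinh a"
  defines "s \<equiv> \<lambda>t. 2 * \<rho> * t - a"
  shows "I t * cosh (s t) = - \<rho> * sinh (s t)"
    and "D t * cosh (s t) = D 0 * cosh a"
    and "R t * cosh (s t) = R 0 * cosh a"
proof -
  have d: "(D has_real_derivative 2 * I t * D t) (at t within T)"
    "(R has_real_derivative 2 * I t * R t) (at t within T)"
    "(I has_real_derivative - 2 * ((D t)\<^sup>2 + (R t)\<^sup>2)) (at t within T)" if "t \<in> T" for t
    using sol that by (auto simp: solves_on_DRI_iff)
  have s: "(s has_real_derivative 2 * \<rho>) (at t within T)" for t
    unfolding s_def by (auto intro!: derivative_eq_intros)
  \<comment> \<open>Only the initial point is assumed to lie on the sphere; D D' + R R' + I I' = 0
    keeps the solution there.\<close>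
  have sph: "(D t)\<^sup>2 + (R t)\<^sup>2 + (I t)\<^sup>2 = \<rho>\<^sup>2" if "t \<in> T" for t
    unfolding sphere[symmetric]
    by (rule zero_derivative_constant[OF T(1,2) that])
      (auto intro!: derivative_eq_intros d simp: algebra_simps power2_eq_square)
  have I_le: "\<bar>I t\<bar> \<le> \<bar>\<rho>\<bar>" if "t \<in> T" for t
    using sph[OF that] by (simp add: abs_le_square_iff add_increasing flip: sph[OF that])
  define W where "W t = I t * cosh (s t) + \<rho> * sinh (s t)" for t
  have W_zero: "W t = 0" if "t \<in> T" for t
  proof (rule linear_ode_zero[OF T(1,2) that, where g = "\<lambda>t. 2 * I t" and K = "2 * \<bar>\<rho>\<bar>"])
    fix t assume t: "t \<in> T"
    \<comment> \<open>On the sphere I' = -2 (\<rho>^2 - I^2), a scalar equation in I alone; with it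
      W' becomes 2 I W.\<close>
    have "(D t)\<^sup>2 + (R t)\<^sup>2 = \<rho>\<^sup>2 - (I t)\<^sup>2" using sph[OF t] by simp
    note dI = d(3)[OF t, unfolded this]
    show "(W has_real_derivative 2 * I t * W t) (at t within T)"
      unfolding W_def
      by (auto intro!: derivative_eq_intros dI s simp: algebra_simps power2_eq_square)
    show "\<bar>2 * I t\<bar> \<le> 2 * \<bar>\<rho>\<bar>" using I_le[OF t] by simp
  qed (simp add: W_def s_def a)
  have const: "u t * cosh (s t) = u 0 * cosh a"
    if u: "\<And>t. t \<in> T \<Longrightarrow> (u has_real_derivative 2 * I t * u t) (at t within T)" for u
  proof -
    have "((\<lambda>t. u t * cosh (s t)) has_real_derivative 2 * u t * W t) (at t within T)"
      if "t \<in> T" for t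
      unfolding W_def
      by (auto intro!: derivative_eq_intros u[OF that] s simp: algebra_simps)
    then have "u t * cosh (s t) = u 0 * cosh (s 0)"
      by (intro zero_derivative_constant[OF T]) (simp add: W_zero)
    then show ?thesis by (simp add: s_def)
  qed
  show "I t * cosh (s t) = - \<rho> * sinh (s t)" using W_zero[OF T(3)] by (simp add: W_def)
  show "D t * cosh (s t) = D 0 * cosh a" "R t * cosh (s t) = R 0 * cosh a"
    using const d by blast+
qed

text \<open>"The solution" is rendered as existence on all of the real line together with
  uniqueness: any solution on an interval containing 0 with the same initial value agrees with the
  formula there, without being assumed to stay on the sphere.\<close>

theorem proposition2p1:
  fixes p\<^sub>1 \<rho> :: real
  assumes "p\<^sub>1 = 1" and "\<rho> > 0"
  shows "(0, 0, \<rho>) \<noteq> - (0, 0, \<rho>)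
      \<and> (\<forall>P \<in> {(0, 0, \<rho>), - (0, 0, \<rho>)}. P \<in> S2 \<rho> \<and> fixed_point (DRI_field p\<^sub>1) P)
      \<and> (\<forall>D0 R0 I0. (D0, R0, I0) \<in> S2 \<rho> \<and> (D0, R0, I0) \<noteq> (0, 0, \<rho>) \<and> (D0, R0, I0) \<noteq> - (0, 0, \<rho>) \<longrightarrow>
      (let X = (\<lambda>\<tau>.
          (\<rho> * D0 / sqrt (D0\<^sup>2 + R0\<^sup>2) * inverse (cosh (2 * p\<^sub>1 * \<rho> * \<tau> - artanh (I0 / \<rho>))),
           \<rho> * R0 / sqrt (D0\<^sup>2 + R0\<^sup>2) * inverse (cosh (2 * p\<^sub>1 * \<rho> * \<tau> - artanh (I0 / \<rho>))),
           - \<rho> * tanh (2 * p\<^sub>1 * \<rho> * \<tau> - artanh (I0 / \<rho>))))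
       in X 0 = (D0, R0, I0)
        \<and> solves_on (DRI_field p\<^sub>1) X UNIV
        \<and> (\<forall>\<tau>. X \<tau> \<in> S2 \<rho>)
        \<and> (\<forall>T Y. is_interval T \<and> 0 \<in> T \<and> solves_on (DRI_field p\<^sub>1) Y T \<and> Y 0 = (D0, R0, I0)
              \<longrightarrow> (\<forall>\<tau>\<in>T. Y \<tau> = X \<tau>))))"
proof (intro conjI allI impI, goal_cases)
  case 1
  show ?case using assms(2) by simp
next
  case 2
  show ?case by (auto simp: S2_def fixed_point_def DRI_field_def zero_prod_def)
next
  case (3 D0 R0 I0)
  define q where "q = sqrt (D0\<^sup>2 + R0\<^sup>2)"
  define a where "a = artanh (I0 / \<rho>)"
  define k where "k = \<rho> * D0 / q"
  define l where "l = \<rho> * R0 / q"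
  define s where "s = (\<lambda>t. 2 * \<rho> * t - a)"
  define X where
    "X = (\<lambda>t. (k * inverse (cosh (s t)), l * inverse (cosh (s t)), - \<rho> * tanh (s t)))"
  have sphere: "D0\<^sup>2 + R0\<^sup>2 + I0\<^sup>2 = \<rho>\<^sup>2" using 3 by (simp add: S2_def)
  \<comment> \<open>On the sphere, D0 = R0 = 0 forces I0 = \<rho> or I0 = -\<rho>, the excluded
    points. Hence \<open>q\<close> is positive and I0 / \<rho> lies strictly between -1 and 1, where
    \<open>artanh\<close> inverts \<open>tanh\<close>.\<close>
  have "\<not> (D0 = 0 \<and> R0 = 0)"
  proof
    assume "D0 = 0 \<and> R0 = 0"
    with sphere 3 show False by (auto simp: power2_eq_iff)
  qed
  then have pos: "D0\<^sup>2 + R0\<^sup>2 > 0" by (simp add: sum_power2_gt_zero_iff)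
  then have q: "q > 0" "q\<^sup>2 = D0\<^sup>2 + R0\<^sup>2" by (simp_all add: q_def)
  have "I0\<^sup>2 < \<rho>\<^sup>2" using pos sphere by linarith
  then have "\<bar>I0\<bar> < \<rho>" using assms(2) abs_le_square_iff[of \<rho> I0] by linarith
  then have I0: "\<bar>I0 / \<rho>\<bar> < 1" using assms(2) by simp
  have tanh_a: "tanh a = I0 / \<rho>" unfolding a_def by (rule tanh_artanh_real[OF I0])
  \<comment> \<open>This identifies \<open>cosh a\<close> as \<rho> / q, so the amplitudes are
    \<open>k\<close> = D0 cosh a and \<open>l\<close> = R0 cosh a: exactly the constants of motion
    of D cosh s and R cosh s.\<close>
  have "1 - (I0 / \<rho>)\<^sup>2 = (q / \<rho>)\<^sup>2"
    using sphere q(2) assms(2) by (simp add: field_simps)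
  then have cosh_a: "cosh a = \<rho> / q"
    using cosh_artanh_real[OF I0] q(1) assms(2) by (simp add: a_def)
  have nz: "cosh (s t) \<noteq> 0" for t using cosh_real_pos[of "s t"] by linarith
  have kl: "k\<^sup>2 + l\<^sup>2 = \<rho>\<^sup>2"
    using \<open>\<not> (D0 = 0 \<and> R0 = 0)\<close>
    by (simp add: k_def l_def power_divide power_mult_distrib q(2)
        flip: add_divide_distrib distrib_left)
  have "X 0 = (D0, R0, I0)"
    using q(1) assms(2) by (simp add: X_def s_def cosh_a tanh_a k_def l_def)
  moreover have "solves_on (DRI_field 1) X UNIV"
    unfolding X_def s_def by (rule DRI_explicit_solution[OF kl])
  moreover have "X t \<in> S2 \<rho>" for t
  proof -
    \<comment> \<open>This is the sphere equation for \<open>X t\<close> after replacing 1 / cosh^2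
      by 1 - tanh^2.\<close>
    have "k\<^sup>2 * (1 - (tanh (s t))\<^sup>2) + l\<^sup>2 * (1 - (tanh (s t))\<^sup>2) + \<rho>\<^sup>2 * (tanh (s t))\<^sup>2 = \<rho>\<^sup>2"
      unfolding kl[symmetric] by (simp add: algebra_simps)
    then show ?thesis
      by (simp only: X_def S2_def mem_Collect_eq case_prod_conv power_mult_distrib
          inverse_cosh_square_real power2_minus)
  qed
  moreover have "Y t = X t"
    if "is_interval T" "0 \<in> T" "solves_on (DRI_field 1) Y T" "Y 0 = (D0, R0, I0)" "t \<in> T" for T Y t
  proof -
    define D R I where "D = fst \<circ> Y" and "R = fst \<circ> snd \<circ> Y" and "I = snd \<circ> snd \<circ> Y"
    have Y: "Y = (\<lambda>t. (D t, R t, I t))" by (simp add: D_def R_def I_def)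
    have init: "D 0 = D0" "R 0 = R0" "I 0 = I0" using that(4) by (simp_all add: Y)
    have "I0 * cosh a = \<rho> * sinh a"
      \<comment> \<open>Clearing denominators in tanh a = I0 / \<rho> yields the phase condition of
        \<open>DRI_first_integrals\<close>.\<close>
      using tanh_a assms(2) cosh_real_pos[of a] by (simp add: tanh_def field_simps)
    note fi = DRI_first_integrals[OF that(1,2,5) that(3)[unfolded Y], unfolded init, OF sphere this]
    show ?thesis
      using fi nz[of t] q(1) by (simp add: Y X_def k_def l_def cosh_a tanh_def s_def field_simps)
  qed
  ultimately show ?case
    \<comment> \<open>With \<open>p\<^sub>1\<close> set to 1, the explicit triple is folded back
      into \<open>X\<close>, both as a function and pointwise, to meet the facts collected
      above.\<close>
    unfolding Let_def assms(1) mult_1_right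
    unfolding q_def[symmetric] a_def[symmetric] k_def[symmetric] l_def[symmetric]
      s_def[THEN fun_cong, symmetric] X_def[symmetric] X_def[THEN fun_cong, symmetric]
    by blast
qed

end
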